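(* Let $r \ge 1$ and $\ell \ge 2$ be integers, and let $m$ be a positive integer with $m \equiv -r \pmod{\ell}$ and $\gcd(m,\ell)=1$. Let $s$ be a non-negative integer such that $m > \frac{2\ell s + r}{\ell - 1}$. Then $$\sum_{n=s}^{\frac{m+r}{\ell}+s} \frac{(q^{-r};q^{\ell})_{n+s}\,(q^{-r};q^{\ell})_{n-s}\,(q^{-r};q^{\ell})_n^2}{(q^{\ell};q^{\ell})_{n+s}\,(q^{\ell};q^{\ell})_{n-s}\,(q^{\ell};q^{\ell})_n^2}\Big\{[\ell(n+s)-r]\,[\ell(n-s)-r]\,[\ell n-r]^2 - [\ell(n+s)]\,[\ell(n-s)]\,[\ell n]^2\Big\} \equiv 0 \pmod{[m]\,\Phi_m(q)^3}.$$
   Context: For the purposes of the congruence, $q$ is treated as an indeterminate and all expressions are rational functions of $q$ (elements of $\mathbb{Q}(q)$). The $q$-shifted factorial is $(a;q)_0 = 1$ and $(a;q)_n = \prod_{k=0}^{n-1}(1-aq^k)$ for $n\ge 1$; thus $(q^{-r};q^{\ell})_n = \prod_{k=0}^{n-1}(1-q^{\ell k - r})$ and $(q^{\ell};q^{\ell})_n = \prod_{k=1}^{n}(1-q^{\ell k})$. A notation such as $(q^{-r};q^{\ell})_n^2$ means the square of $(q^{-r};q^{\ell})_n$. For any integer $k$ (possibly negative or zero), $[k] = \frac{1-q^k}{1-q}$ is the $q$-integer; for positive $m$, $[m] = 1+q+\cdots+q^{m-1}$. $\Phi_m(q)$ is the $m$-th cyclotomic polynomial. Congruence convention: for a rational function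 $A(q)$ and a polynomial $P(q)\in\mathbb{Z}[q]$, $A(q)\equiv 0 \pmod{P(q)}$ means that, when $A(q)$ is written in lowest terms as a quotient of two polynomials, $P(q)$ divides the numerator (equivalently, $A(q) = P(q)\,B(q)/C(q)$ with $B, C$ polynomials and $C$ coprime to $P$). Powers of $q$ are coprime to $P$ here, so negative powers of $q$ cause no difficulty. *)

theory Defs
  imports
    "HOL-Computational_Algebra.Computational_Algebra"
    "HOL-Computational_Algebra.Field_as_Ring"
    "HOL-Number_Theory.Cong"
begin

section \<open>The field of rational functions in \<open>q\<close>\<close>

text \<open>\<open>\<rat>(q)\<close> is the fraction field \<^typ>\<open>rat poly fract\<close> of \<open>\<rat>[q]\<close>.\<close>

type_synonym ratfun = "rat poly fract"

definition qvar :: ratfun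
  where "qvar = to_fract [:0, 1:]"

text \<open>\<open>qpoch a x n\<close> is \<open>(a; x)\<^sub>n\<close>.\<close>

definition qpoch :: "'a::comm_ring_1 \<Rightarrow> 'a \<Rightarrow> nat \<Rightarrow> 'a"
  where "qpoch a x n = (\<Prod>k<n. 1 - a * x ^ k)"

definition qint :: "int \<Rightarrow> ratfun"
  where "qint k = (1 - qvar powi k) / (1 - qvar)"

text \<open>
  A modulus has to be a polynomial, so \<open>[m]\<close> is also needed as an element of \<open>\<rat>[q]\<close>; see
  \<open>to_fract_qint_poly\<close> below for the agreement with \<^const>\<open>qint\<close>.
\<close>

definition qint_poly :: "nat \<Rightarrow> rat poly"
  where "qint_poly m = (\<Sum>i<m. [:0, 1:] ^ i)"

text \<open>
  \<^const>\<open>quot_of_fract\<close> yields the numerator and denominator in lowest terms (with monic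
  denominator). Divisibility is taken in \<open>\<rat>[q]\<close>; for a monic modulus in \<open>\<int>[q]\<close>, reducing the
  fraction and dividing over \<open>\<int>\<close> gives the same relation.
\<close>

definition ratfun_cong_0 :: "ratfun \<Rightarrow> rat poly \<Rightarrow> bool"
  where "ratfun_cong_0 A P \<longleftrightarrow> P dvd fst (quot_of_fract A)"


section \<open>Cyclotomic polynomials\<close>

definition primitive_roots_unity :: "nat \<Rightarrow> complex set"
  where "primitive_roots_unity m = {z. z ^ m = 1 \<and> (\<forall>k. 0 < k \<and> k < m \<longrightarrow> z ^ k \<noteq> 1)}"

text \<open>
  \<open>cyclotomic m\<close> is \<open>\<Phi>\<^sub>m\<close>: the product of \<open>q - \<zeta>\<close> over the primitive \<open>m\<close>-th roots of unity \<open>\<zeta>\<close>,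
  regarded as a polynomial over \<open>\<rat>\<close>. For \<open>m > 0\<close> the definite description is justified by
  \<open>of_rat_cyclotomic\<close> below; for \<open>m = 0\<close> the index set is infinite and the product degenerates
  to \<open>1\<close>.
\<close>

definition cyclotomic :: "nat \<Rightarrow> rat poly"
  where "cyclotomic m =
    (THE p. map_poly of_rat p = (\<Prod>z\<in>primitive_roots_unity m. [:- z, 1:]))"


section \<open>Adequacy of the definitions\<close>

lemma to_fract_power: "to_fract (p ^ n) = to_fract p ^ n"
  by (induction n) simp_all

lemma to_fract_sum: "to_fract (sum f A) = (\<Sum>x\<in>A. to_fract (f x))"
  by (induction A rule: infinite_finite_induct) simp_all

lemma qvar_neq_0: "qvar \<noteq> 0"
  by (simp add: qvar_def)

lemma qvar_neq_1: "qvar \<noteq> 1"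
proof
  assume "qvar = 1"
  hence "to_fract [:0, 1 :: rat:] = to_fract 1"
    by (simp add: qvar_def)
  thus False
    by (simp only: to_fract_eq_iff) (simp add: one_pCons)
qed

lemma to_fract_qint_poly: "to_fract (qint_poly m) = qint (int m)"
proof -
  have "to_fract (qint_poly m) = (\<Sum>i<m. qvar ^ i)"
    by (simp add: qint_poly_def qvar_def to_fract_sum to_fract_power)
  also have "\<dots> = qint (int m)"
    using qvar_neq_1 by (simp add: qint_def sum_gp_strict)
  finally show ?thesis .
qed

lemma ratfun_cong_0_iff:
  "ratfun_cong_0 A P \<longleftrightarrow>
     (\<exists>B C. C \<noteq> 0 \<and> coprime C P \<and> A = to_fract (P * B) / to_fract C)"
proof
  assume "ratfun_cong_0 A P"
  then obtain B where B: "fst (quot_of_fract A) = P * B"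
    unfolding ratfun_cong_0_def by (elim dvdE)
  have nf: "quot_of_fract A \<in> normalized_fracts"
    by simp
  hence cop: "coprime (P * B) (snd (quot_of_fract A))"
    unfolding B [symmetric] by (simp add: normalized_fracts_def case_prod_unfold)
  have "snd (quot_of_fract A) \<noteq> 0"
    using nf by (metis not_normalized_fracts_0_denom prod.collapse)
  moreover have "coprime (snd (quot_of_fract A)) P"
    using cop by (simp add: coprime_commute)
  moreover have "A = to_fract (P * B) / to_fract (snd (quot_of_fract A))"
  proof -
    have "A = quot_to_fract (quot_of_fract A)"
      by simp
    also have "\<dots> = to_fract (P * B) / to_fract (snd (quot_of_fract A))"
      unfolding quot_to_fract_def case_prod_unfold Fract_conv_to_fract B ..
    finally show ?thesis .
  qed
  ultimately show "\<exists>B C. C \<noteq> 0 \<and> coprime C P \<and> A = to_fract (P * B) / to_fract C"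
    by blast
next
  assume "\<exists>B C. C \<noteq> 0 \<and> coprime C P \<and> A = to_fract (P * B) / to_fract C"
  then obtain B C where C: "C \<noteq> 0" "coprime C P" "A = to_fract (P * B) / to_fract C"
    by blast
  have "quot_of_fract A = normalize_quot (P * B, C)"
    using quot_of_fract_quot_to_fract [of "(P * B, C)"] C
    by (simp add: quot_to_fract_def Fract_conv_to_fract)
  then obtain d where d: "P * B = fst (quot_of_fract A) * d" "C = snd (quot_of_fract A) * d"
    using normalize_quotE [OF C(1), of "P * B"] by metis
  have "coprime P d"
    using C(2) d(2) by (metis coprime_commute coprime_mult_right_iff)
  moreover have "P dvd fst (quot_of_fract A) * d"
    using d(1) by (metis dvd_triv_left)
  ultimately show "ratfun_cong_0 A P"
    unfolding ratfun_cong_0_def by (simp add: coprime_dvd_mult_left_iff)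
qed

lemma finite_primitive_roots_unity: "m > 0 \<Longrightarrow> finite (primitive_roots_unity m)"
  by (rule finite_subset [OF _ finite_roots_unity [of m]]) (auto simp: primitive_roots_unity_def)

lemma roots_unity_conv_primitive:
  assumes "n > 0"
  shows "{z::complex. z ^ n = 1} = (\<Union>d\<in>{d. d dvd n}. primitive_roots_unity d)"
proof (intro equalityI subsetI)
  fix z :: complex
  assume "z \<in> {z. z ^ n = 1}"
  hence z: "z ^ n = 1" by simp
  define d where "d = (LEAST k. k > 0 \<and> z ^ k = 1)"
  have d: "d > 0 \<and> z ^ d = 1"
    unfolding d_def by (rule LeastI [of _ n]) (use z assms in auto)
  have min: "z ^ k \<noteq> 1" if "0 < k" "k < d" for k
    using not_less_Least [of k "\<lambda>k. k > 0 \<and> z ^ k = 1"] that unfolding d_def by auto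
  have "z ^ (n mod d) = (z ^ d) ^ (n div d) * z ^ (n mod d)"
    using d by simp
  also have "\<dots> = z ^ n"
    by (simp flip: power_mult power_add)
  finally have "z ^ (n mod d) = 1"
    using z by simp
  hence "n mod d = 0"
    using min [of "n mod d"] d by (meson mod_less_divisor not_gr_zero)
  hence "d dvd n" by presburger
  moreover have "z \<in> primitive_roots_unity d"
    using d min by (auto simp: primitive_roots_unity_def)
  ultimately show "z \<in> (\<Union>d\<in>{d. d dvd n}. primitive_roots_unity d)"
    by blast
next
  fix z :: complex
  assume "z \<in> (\<Union>d\<in>{d. d dvd n}. primitive_roots_unity d)"
  thus "z \<in> {z. z ^ n = 1}"
    by (auto simp: primitive_roots_unity_def power_mult elim!: dvdE)
qed

lemma disjoint_primitive_roots_unity: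
  assumes "d > 0" "e > 0" "d \<noteq> e"
  shows "primitive_roots_unity d \<inter> primitive_roots_unity e = {}"
  using assms by (auto simp: primitive_roots_unity_def) (metis linorder_neqE_nat)

lemma prod_linear_monic:
  "coeff (\<Prod>z\<in>A. [:- z, 1:]) (card A) = (1::'a::idom)"
  "degree (\<Prod>z\<in>A. [:- z, 1:] :: 'a::idom poly) = card A"
proof -
  show deg: "degree (\<Prod>z\<in>A. [:- z, 1:] :: 'a poly) = card A"
    by (simp add: degree_prod_sum_eq)
  have "lead_coeff (\<Prod>z\<in>A. [:- z, 1:] :: 'a poly) = 1"
    by (simp add: lead_coeff_prod)
  thus "coeff (\<Prod>z\<in>A. [:- z, 1:]) (card A) = (1::'a)"
    unfolding deg .
qed

lemma prod_primitive_roots_unity: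
  assumes "n > 0"
  shows "(\<Prod>d | d dvd n. \<Prod>z\<in>primitive_roots_unity d. [:- z, 1:]) = monom 1 n - 1"
proof -
  let ?R = "{z::complex. z ^ n = 1}"
  have fin: "finite ?R" and card: "card ?R = n"
    using assms by (simp_all add: finite_roots_unity card_roots_unity_eq)
  have pos: "d > 0" if "d dvd n" for d
    using that assms by (auto intro: Nat.gr0I)
  have "(\<Prod>d | d dvd n. \<Prod>z\<in>primitive_roots_unity d. [:- z, 1:])
          = (\<Prod>z\<in>(\<Union>d\<in>{d. d dvd n}. primitive_roots_unity d). [:- z, 1:])"
    using assms pos
    by (intro prod.UNION_disjoint [symmetric])
       (auto simp: finite_primitive_roots_unity disjoint_primitive_roots_unity)
  also have "\<dots> = (\<Prod>z\<in>?R. [:- z, 1:])"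
    by (simp only: roots_unity_conv_primitive [OF assms])
  also have "\<dots> = monom 1 n - 1"
  proof (rule poly_eqI_degree_lead_coeff [where n = n and A = ?R])
    show "coeff (\<Prod>z\<in>?R. [:- z, 1:]) n = coeff (monom 1 n - 1) n"
      using prod_linear_monic(1) [of ?R] assms card by simp
    show "degree (\<Prod>z\<in>?R. [:- z, 1:]) \<le> n"
      using card by (simp add: prod_linear_monic)
    show "degree (monom 1 n - 1 :: complex poly) \<le> n"
      by (intro degree_diff_le) (auto simp: degree_monom_le)
  qed (use fin card in \<open>auto simp: poly_prod poly_monom\<close>)
  finally show ?thesis .
qed

lemma of_rat_poly_mult:
  "map_poly of_rat (p * q) = map_poly of_rat p * (map_poly of_rat q :: 'a::field_char_0 poly)"
  by (rule poly_eqI) (simp add: coeff_map_poly coeff_mult of_rat_sum of_rat_mult)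

lemma of_rat_poly_add:
  "map_poly of_rat (p + q) = map_poly of_rat p + (map_poly of_rat q :: 'a::field_char_0 poly)"
  by (rule poly_eqI) (simp add: coeff_map_poly of_rat_add)

lemma of_rat_poly_prod:
  "map_poly of_rat (prod f A) = (\<Prod>x\<in>A. map_poly of_rat (f x) :: 'a::field_char_0 poly)"
  by (induction A rule: infinite_finite_induct) (simp_all add: of_rat_poly_mult)

lemma of_rat_poly_inj:
  "map_poly of_rat p = (map_poly of_rat q :: 'a::field_char_0 poly) \<Longrightarrow> p = q"
  by (simp add: poly_eq_iff coeff_map_poly)

lemma degree_of_rat_poly [simp]:
  "degree (map_poly of_rat p :: 'a::field_char_0 poly) = degree p"
  by (simp add: degree_map_poly)

lemma cyclotomic_exists:
  assumes "m > 0"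
  shows "\<exists>p :: rat poly. map_poly of_rat p = (\<Prod>z\<in>primitive_roots_unity m. [:- z, 1:])"
  using assms
proof (induction m rule: less_induct)
  case (less m)
  let ?C = "\<lambda>m. \<Prod>z\<in>primitive_roots_unity m. [:- z, 1:]"
  let ?h = "map_poly of_rat :: rat poly \<Rightarrow> complex poly"
  define S where "S = {d. d dvd m \<and> d \<noteq> m}"
  have S: "d < m" "d > 0" if "d \<in> S" for d
    using that less.prems by (auto simp: S_def intro: Nat.gr0I dest: dvd_imp_le)
  obtain f where f: "?h (f d) = ?C d" if "d \<in> S" for d
    using less.IH S by metis
  define Q where "Q = prod f S"
  have hQ: "?h Q = (\<Prod>d\<in>S. ?C d)"
    by (simp add: Q_def of_rat_poly_prod f)
  have "?h Q \<noteq> 0"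
    unfolding hQ using S finite_primitive_roots_unity by (auto simp: S_def less.prems)
  hence Q0: "Q \<noteq> 0" by auto
  have "{d. d dvd m} = insert m S" "m \<notin> S" "finite S"
    using less.prems by (auto simp: S_def)
  hence eq: "?C m * ?h Q = monom 1 m - 1"
    using prod_primitive_roots_unity [OF less.prems] by (simp add: hQ)
  define X :: "rat poly" where "X = monom 1 m - 1"
  have hX: "?h X = monom 1 m - 1"
    by (rule poly_eqI) (simp add: X_def coeff_map_poly of_rat_diff)
  have "?h X = ?h (X div Q) * ?h Q + ?h (X mod Q)"
    by (simp flip: of_rat_poly_mult of_rat_poly_add)
  hence *: "?h (X mod Q) = (?C m - ?h (X div Q)) * ?h Q"
    using eq hX by (simp add: algebra_simps)
  have "?C m - ?h (X div Q) = 0"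
  proof (rule ccontr)
    assume ne: "?C m - ?h (X div Q) \<noteq> 0"
    hence "?h (X mod Q) \<noteq> 0"
      unfolding * using \<open>?h Q \<noteq> 0\<close> by simp
    hence "X mod Q \<noteq> 0" by auto
    hence "degree (X mod Q) < degree Q"
      using Q0 degree_mod_less by blast
    moreover have "degree (X mod Q) = degree (?C m - ?h (X div Q)) + degree Q"
      using arg_cong [OF *, of degree] degree_mult_eq [OF ne \<open>?h Q \<noteq> 0\<close>] by simp
    ultimately show False by simp
  qed
  hence "?h (X div Q) = ?C m" by simp
  thus ?case by blast
qed

lemma of_rat_cyclotomic:
  assumes "m > 0"
  shows "map_poly of_rat (cyclotomic m) = (\<Prod>z\<in>primitive_roots_unity m. [:- z, 1:])"
proof -
  have "\<exists>!p :: rat poly. map_poly of_rat p = (\<Prod>z\<in>primitive_roots_unity m. [:- z, 1:])"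
    using cyclotomic_exists [OF assms] by (metis of_rat_poly_inj)
  thus ?thesis
    unfolding cyclotomic_def by (rule theI')
qed

end

theory Submission
  imports Defs
begin

text \<open>
  With \<open>b\<^sub>k = (q\<^sup>-\<^sup>r; q\<^sup>l)\<^sub>k\<^sub>+\<^sub>1 / ((q\<^sup>l; q\<^sup>l)\<^sub>k (1 - q))\<close>, the summand is
  \<open>F(n) - F(n - 1)\<close> for \<open>F(n) = b\<^sub>n\<^sub>+\<^sub>s b\<^sub>n\<^sub>-\<^sub>s b\<^sub>n\<^sup>2\<close>, so the sum collapses to \<open>F(N + s)\<close> where
  \<open>l N = m + r\<close>. The congruence is then a comparison of multiplicities at each root \<open>z \<noteq> 1\<close> of
  \<open>z\<^sup>m = 1\<close>. With \<open>w = z\<^sup>l\<close>, the multiplicity of \<open>b\<^sub>k\<close> is the number of \<open>0 \<le> j \<le> k\<close> with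
  \<open>w\<^sup>j = w\<^sup>N\<close> minus the number of \<open>1 \<le> j \<le> k\<close> with \<open>w\<^sup>j = 1\<close>. This is never negative, it is positive
  for \<open>k = N\<close>, and if \<open>z\<close> is primitive it is positive for all four factors, because the bound on
  \<open>m\<close> says that \<open>N + 2 s < m\<close> and so no denominator vanishes at \<open>z\<close>.
\<close>

subsection \<open>Divisibility read off from multiplicities of complex roots\<close>

lemma order_prod:
  fixes f :: "'b \<Rightarrow> 'a::idom poly"
  assumes "\<And>x. x \<in> A \<Longrightarrow> f x \<noteq> 0"
  shows "order z (prod f A) = (\<Sum>x\<in>A. order z (f x))"
  using assms
proof (induction A rule: infinite_finite_induct)
  case (insert x A)
  hence "f x * prod f A \<noteq> 0"
    by auto
  thus ?case
    using insert by (simp add: order_mult)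
qed simp_all

lemma order_power:
  fixes p :: "'a::idom poly"
  assumes "p \<noteq> 0"
  shows "order z (p ^ n) = n * order z p"
  using order_prod [of "{..<n}" "\<lambda>_. p" z] assms by simp

text \<open>Over the complex numbers a polynomial is its leading coefficient times the linear
  factors of its roots, so inclusion of root multisets yields divisibility.\<close>

lemma complex_poly_dvd_orderI:
  fixes p q :: "complex poly"
  assumes "p \<noteq> 0" "q \<noteq> 0" and "\<And>z. poly p z = 0 \<Longrightarrow> order z p \<le> order z q"
  shows "p dvd q"
proof -
  have "proots p \<subseteq># proots q"
  proof (rule mset_subset_eqI)
    fix z
    show "count (proots p) z \<le> count (proots q) z"
      using assms by (cases "poly p z = 0") (auto simp: order_0I)
  qed
  hence "(\<Prod>z\<in>#proots p. [:- z, 1:]) dvd (\<Prod>z\<in>#proots q. [:- z, 1:])"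
    by (intro prod_mset_subset_imp_dvd image_mset_subseteq_mono)
  hence "smult (lead_coeff p) (\<Prod>z\<in>#proots p. [:- z, 1:])
      dvd smult (lead_coeff q) (\<Prod>z\<in>#proots q. [:- z, 1:])"
    using assms(1,2) by (simp add: smult_dvd_iff dvd_smult)
  thus ?thesis
    by (simp only: complex_poly_decompose_multiset)
qed

text \<open>The embedding of coefficients preserves degrees. The image of the remainder
  \<open>q mod p\<close> is divisible by the image of \<open>p\<close>, so it vanishes by
  degree.\<close>

lemma of_rat_poly_dvdD:
  assumes "map_poly of_rat p dvd (map_poly of_rat q :: 'a::field_char_0 poly)"
  shows "p dvd q"
proof (cases "p = 0")
  case True
  thus ?thesis
    using assms of_rat_poly_inj [of q 0, where 'a = 'a] by simp
next
  case False
  let ?h = "map_poly of_rat :: rat poly \<Rightarrow> 'a poly"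
  have "?h q = ?h (q div p) * ?h p + ?h (q mod p)"
    by (simp flip: of_rat_poly_mult of_rat_poly_add)
  hence "?h p dvd ?h (q mod p)"
    using assms by (simp add: dvd_add_right_iff)
  moreover have "degree (?h (q mod p)) < degree (?h p) \<or> q mod p = 0"
    using degree_mod_less [OF False, of q] by auto
  ultimately have "?h (q mod p) = ?h 0"
    by (auto dest: dvd_imp_degree_le)
  hence "q mod p = 0"
    by (rule of_rat_poly_inj)
  thus ?thesis
    by (simp add: mod_eq_0_iff_dvd)
qed

lemma of_rat_poly_eq_0_iff:
  "map_poly of_rat p = (0 :: 'a::field_char_0 poly) \<longleftrightarrow> p = 0"
  using of_rat_poly_inj [of p 0, where 'a = 'a] by auto

text \<open>The fraction need not be reduced: a common factor \<open>d\<close> adds the same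
  multiplicity to both sides of the inequality, so the bound survives the passage to lowest
  terms.\<close>

lemma ratfun_cong_0_orderI:
  fixes P X Y :: "rat poly"
  defines "h \<equiv> map_poly of_rat :: rat poly \<Rightarrow> complex poly"
  assumes nz: "X \<noteq> 0" "Y \<noteq> 0" "P \<noteq> 0"
    and le: "\<And>z. poly (h P) z = 0 \<Longrightarrow> order z (h P) + order z (h Y) \<le> order z (h X)"
  shows "ratfun_cong_0 (to_fract X / to_fract Y) P"
proof -
  let ?A = "fst (normalize_quot (X, Y))" and ?C = "snd (normalize_quot (X, Y))"
  have eq: "quot_of_fract (to_fract X / to_fract Y) = normalize_quot (X, Y)"
    using quot_of_fract_quot_to_fract [of "(X, Y)"]
    by (simp add: quot_to_fract_def Fract_conv_to_fract)
  obtain d where d: "X = ?A * d" "Y = ?C * d" "d \<noteq> 0"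
    using normalize_quotE [OF nz(2), of X] by metis
  have h0: "h p = 0 \<longleftrightarrow> p = 0" for p
    by (simp add: h_def of_rat_poly_eq_0_iff)
  have "h P dvd h ?A"
  proof (rule complex_poly_dvd_orderI)
    have A0: "?A \<noteq> 0"
      using nz(1) d(1) by (metis mult_zero_left)
    show "h P \<noteq> 0"
      using nz(3) by (simp add: h0)
    show "h ?A \<noteq> 0"
      using A0 by (simp add: h0)
    fix z assume "poly (h P) z = 0"
    from le [OF this] have "order z (h P) + order z (h (?C * d)) \<le> order z (h (?A * d))"
      by (simp only: d [symmetric])
    moreover have "order z (h (?C * d)) = order z (h ?C) + order z (h d)"
      using d(3) h0 by (simp add: h_def of_rat_poly_mult order_mult)
    moreover have "order z (h (?A * d)) = order z (h ?A) + order z (h d)"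
      using d(3) h0 A0 by (simp add: h_def of_rat_poly_mult order_mult)
    ultimately show "order z (h P) \<le> order z (h ?A)"
      by linarith
  qed
  hence "P dvd ?A"
    unfolding h_def by (rule of_rat_poly_dvdD)
  thus ?thesis
    by (simp add: ratfun_cong_0_def eq)
qed

text \<open>Nonzero roots are simple: at such a root, \<open>z\<close> times the derivative is
  \<open>(a - b) * z ^ a\<close>, which is nonzero in characteristic 0.\<close>

lemma order_monom_diff:
  fixes z :: "'a::field_char_0"
  assumes "a \<noteq> b" "z \<noteq> 0"
  shows "order z (monom 1 a - monom 1 b) = (if z ^ a = z ^ b then 1 else 0)"
proof (cases "z ^ a = z ^ b")
  case True
  let ?p = "monom 1 a - monom 1 b :: 'a poly"
  have nz: "?p \<noteq> 0"
    using assms(1) by (auto simp: poly_eq_iff)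
  \<comment> \<open>The extra factor \<open>z\<close> restores the exponent lowered by
    differentiation and also covers the truncated \<open>k - 1\<close> at
    \<open>k = 0\<close>.\<close>
  have pow: "z * (of_nat k * z ^ (k - 1)) = of_nat k * z ^ k" for k
    by (cases k) simp_all
  have "z * poly (pderiv ?p) z = of_nat a * z ^ a - of_nat b * z ^ b"
    by (simp only: pderiv_diff pderiv_monom poly_diff poly_monom right_diff_distrib mult_1_right pow)
  also have "\<dots> = (of_nat a - of_nat b) * z ^ a"
    using True by (simp add: algebra_simps)
  finally have "poly (pderiv ?p) z \<noteq> 0"
    using assms by auto
  hence "order z (pderiv ?p) = 0"
    by (rule order_0I)
  thus ?thesis
    using order_pderiv [OF nz, of z] True by (simp add: poly_monom)
qed (simp add: order_0I poly_monom)

lemma order_prod_linear: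
  fixes S :: "'a::idom set"
  assumes "finite S"
  shows "order z (\<Prod>w\<in>S. [:- w, 1:]) = (if z \<in> S then 1 else 0)"
proof -
  have "order z [:- w, 1:] = (if w = z then 1 else 0)" for w
    using order_power_n_n [of z 1] by (auto intro: order_0I)
  thus ?thesis
    using assms by (subst order_prod) auto
qed

subsection \<open>Counting powers of a root of unity\<close>

lemma root_of_unity_order:
  fixes w :: complex
  assumes "w ^ m = 1" "m > 0"
  obtains d where "d > 0" "\<And>k. w ^ k = 1 \<longleftrightarrow> d dvd k"
proof -
  have "w \<in> {z. z ^ m = 1}"
    using assms by simp
  then obtain d where "d dvd m" and d: "w \<in> primitive_roots_unity d"
    using roots_unity_conv_primitive [OF assms(2)] by auto
  hence "d > 0"
    using assms(2) by (auto intro: Nat.gr0I)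
  have mod: "w ^ k = w ^ (k mod d)" for k
  proof -
    have "w ^ k = (w ^ d) ^ (k div d) * w ^ (k mod d)"
      by (simp flip: power_mult power_add)
    thus ?thesis
      using d by (simp add: primitive_roots_unity_def)
  qed
  have "w ^ k = 1 \<longleftrightarrow> d dvd k" for k
  proof
    assume "w ^ k = 1"
    hence "w ^ (k mod d) = 1"
      by (simp only: mod [symmetric])
    hence "k mod d = 0"
      using d \<open>d > 0\<close> mod_less_divisor [of d k] by (auto simp: primitive_roots_unity_def)
    thus "d dvd k"
      by (simp only: dvd_eq_mod_eq_0)
  next
    assume "d dvd k"
    thus "w ^ k = 1"
      using mod [of k] by (simp add: dvd_eq_mod_eq_0)
  qed
  thus ?thesis
    using that \<open>d > 0\<close> by blast
qed

text \<open>
  The map \<open>j \<mapsto> j - d + N mod d\<close>, where \<open>d\<close> is the order of \<open>w\<close>, sends the exponents counted on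
  the left to those on the right; it moves every exponent downwards, so it misses \<open>N\<close> if \<open>k = N\<close>.
\<close>

lemma card_powers_eq_1_le:
  fixes w :: complex
  assumes "w ^ m = 1" "m > 0"
  shows "card {j\<in>{1..k}. w ^ j = 1} \<le> card {j\<in>{..k}. w ^ j = w ^ N}"
    and "card {j\<in>{1..N}. w ^ j = 1} < card {j\<in>{..N}. w ^ j = w ^ N}"
proof -
  obtain d where "d > 0" and d: "\<And>k. w ^ k = 1 \<longleftrightarrow> d dvd k"
    using root_of_unity_order [OF assms] by blast
  define f where "f j = j - d + N mod d" for j
  have f: "w ^ f j = w ^ N \<and> f j < j" if "j \<in> {j\<in>{1..k}. w ^ j = 1}" for j k
  proof -
    have "d dvd j" "d \<le> j"
      using that d by (auto dest: dvd_imp_le)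
    hence "w ^ (j - d) = 1"
      using d by simp
    moreover have "w ^ N = (w ^ d) ^ (N div d) * w ^ (N mod d)"
      by (simp flip: power_mult power_add)
    ultimately have "w ^ f j = w ^ N"
      using d [of d] by (simp add: f_def power_add)
    moreover have "f j < j"
      using \<open>d \<le> j\<close> \<open>d > 0\<close> mod_less_divisor [of d N] unfolding f_def by linarith
    ultimately show ?thesis ..
  qed
  \<comment> \<open>Each counted \<open>j\<close> is a positive multiple of \<open>d\<close>, so
    \<open>j - d\<close> does not truncate.\<close>
  have inj: "inj_on f {j\<in>{1..k}. w ^ j = 1}" for k
    using d by (auto simp: inj_on_def f_def dest!: dvd_imp_le)
  show "card {j\<in>{1..k}. w ^ j = 1} \<le> card {j\<in>{..k}. w ^ j = w ^ N}"
    using f [of _ k] by (intro card_inj_on_le [OF inj]) fastforce+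
  have fN: "f j < N" "w ^ f j = w ^ N" if "j \<in> {j\<in>{1..N}. w ^ j = 1}" for j
    using f [OF that] that by auto
  have "card {j\<in>{1..N}. w ^ j = 1} \<le> card {j\<in>{..<N}. w ^ j = w ^ N}"
    using fN by (intro card_inj_on_le [OF inj]) auto
  also have "\<dots> < card {j\<in>{..N}. w ^ j = w ^ N}"
    by (rule psubset_card_mono) auto
  finally show "card {j\<in>{1..N}. w ^ j = 1} < card {j\<in>{..N}. w ^ j = w ^ N}" .
qed

subsection \<open>The telescoping sum\<close>

lemma qpoch_Suc: "qpoch a x (Suc n) = qpoch a x n * (1 - a * x ^ n)"
  by (simp add: qpoch_def)

text \<open>The factor \<open>1 - a * x ^ k\<close> extends the upper symbol by one, while
  \<open>1 - x ^ k\<close> cancels the last factor of the lower one. Both products thus come from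
  the same sequence \<open>b\<close>, at neighbouring indices.\<close>

lemma telescope_step:
  fixes a x c :: "'a::field"
  assumes x: "\<forall>k>0. x ^ k \<noteq> 1"
  defines "b \<equiv> (\<lambda>k. qpoch a x (Suc k) / qpoch x x k)"
  shows "qpoch a x k / qpoch x x k * ((1 - a * x ^ k) / c) = b k / c"
    and "k > 0 \<Longrightarrow> qpoch a x k / qpoch x x k * ((1 - x ^ k) / c) = b (k - 1) / c"
proof -
  show "qpoch a x k / qpoch x x k * ((1 - a * x ^ k) / c) = b k / c"
    by (simp add: b_def qpoch_Suc)
  assume "k > 0"
  then obtain i where i: "k = Suc i"
    by (cases k) auto
  show "qpoch a x k / qpoch x x k * ((1 - x ^ k) / c) = b (k - 1) / c"
    using x [rule_format, of k] by (simp add: b_def i qpoch_Suc)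
qed

lemma telescoping_sum:
  fixes a x c :: "'a::field"
  assumes x: "\<forall>k>0. x ^ k \<noteq> 1"
  defines "b \<equiv> (\<lambda>k. qpoch a x (Suc k) / qpoch x x k)"
  shows "(\<Sum>n = s..N + s.
       (qpoch a x (n + s) * qpoch a x (n - s) * (qpoch a x n) ^ 2)
       / (qpoch x x (n + s) * qpoch x x (n - s) * (qpoch x x n) ^ 2)
       * ((1 - a * x ^ (n + s)) / c * ((1 - a * x ^ (n - s)) / c) * ((1 - a * x ^ n) / c) ^ 2
          - (1 - x ^ (n + s)) / c * ((1 - x ^ (n - s)) / c) * ((1 - x ^ n) / c) ^ 2))
     = b (N + 2 * s) / c * (b N / c) * (b (N + s) / c) ^ 2" (is "sum ?t _ = _")
proof -
  define u where "u k = qpoch a x k / qpoch x x k" for k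
  define U where "U k = u k * ((1 - a * x ^ k) / c)" for k
  define V where "V k = u k * ((1 - x ^ k) / c)" for k
  have U: "U k = b k / c" for k
    using telescope_step(1) [OF x] by (simp add: U_def u_def b_def)
  \<comment> \<open>The value 0 at \<open>k = 0\<close> kills the subtracted product at
    \<open>n = s\<close>, so the telescoping sum has no lower boundary term.\<close>
  have V: "V k = (if k = 0 then 0 else b (k - 1) / c)" for k
    using telescope_step(2) [OF x] by (simp add: V_def u_def b_def)
  have t: "?t n = U (n + s) * U (n - s) * U n ^ 2 - V (n + s) * V (n - s) * V n ^ 2" for n
  proof -
    have "p * q * v ^ 2 / (p' * q' * v' ^ 2) * (A * B * C ^ 2 - A' * B' * C' ^ 2)
        = (p / p' * A) * (q / q' * B) * (v / v' * C) ^ 2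
          - (p / p' * A') * (q / q' * B') * (v / v' * C') ^ 2"
      for p q v p' q' v' A B C A' B' C' :: 'a
      by (simp add: right_diff_distrib diff_divide_distrib power_mult_distrib power_divide mult_ac)
    thus ?thesis
      unfolding U_def V_def u_def .
  qed
  show ?thesis
    unfolding t
  proof (induction N)
    case 0
    show ?case
      by (simp add: U V mult_2)
  next
    case (Suc N)
    have "Suc N + s + s = Suc (N + s + s)" "Suc N + s - s = Suc N" "N + 2 * s = N + s + s"
      by simp_all
    thus ?case
      using Suc by (simp add: U V mult_2 add_ac)
  qed
qed

subsection \<open>Numerators and denominators as polynomials\<close>

text \<open>Each of the \<open>k + 1\<close> factors of the upper symbol is multiplied by
  \<open>q ^ r\<close> to clear its negative exponent.\<close>

definition num_poly :: "nat \<Rightarrow> nat \<Rightarrow> nat \<Rightarrow> 'a::comm_ring_1 poly"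
  where "num_poly r l k = (\<Prod>j\<le>k. monom 1 r - monom 1 (l * j))"

text \<open>The leading monomial compensates for the powers of \<open>q\<close> put into
  \<open>num_poly\<close>; the last factor is the denominator of a q-integer. Writing 1 as
  \<open>monom 1 0\<close> makes every other factor a difference of monomials, as
  \<open>order_monom_diff\<close> expects.\<close>

definition den_poly :: "nat \<Rightarrow> nat \<Rightarrow> nat \<Rightarrow> 'a::comm_ring_1 poly"
  where "den_poly r l k =
    monom 1 (r * Suc k) * (\<Prod>j\<in>{1..k}. monom 1 0 - monom 1 (l * j)) * (monom 1 0 - monom 1 1)"

lemma monom_1_eq_iff:
  "monom 1 a = (monom 1 b :: 'a::comm_ring_1 poly) \<longleftrightarrow> a = b"
  "monom 1 a = (1 :: 'a poly) \<longleftrightarrow> a = 0"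
proof -
  show "monom 1 a = (monom 1 b :: 'a poly) \<longleftrightarrow> a = b" for b
    by (metis degree_monom_eq zero_neq_one)
  from this [of 0] show "monom 1 a = (1 :: 'a poly) \<longleftrightarrow> a = 0"
    by simp
qed

lemma num_poly_nonzero:
  assumes "\<not> l dvd r"
  shows "num_poly r l k \<noteq> (0 :: 'a::idom poly)"
  using assms by (auto simp: num_poly_def monom_1_eq_iff)

lemma den_poly_nonzero:
  assumes "l > 0"
  shows "den_poly r l k \<noteq> (0 :: 'a::idom poly)"
  using assms by (auto simp: den_poly_def monom_1_eq_iff)

lemma of_rat_monom_diff:
  "map_poly of_rat (monom 1 a - monom 1 b) = (monom 1 a - monom 1 b :: 'a::field_char_0 poly)"
  by (rule poly_eqI) (simp add: coeff_map_poly of_rat_diff)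

lemma of_rat_num_poly:
  "map_poly of_rat (num_poly r l k) = (num_poly r l k :: 'a::field_char_0 poly)"
  by (simp add: num_poly_def of_rat_poly_prod of_rat_monom_diff)

lemma of_rat_den_poly:
  "map_poly of_rat (den_poly r l k) = (den_poly r l k :: 'a::field_char_0 poly)"
  by (simp only: den_poly_def of_rat_poly_mult of_rat_poly_prod of_rat_monom_diff
      map_poly_monom of_rat_0 of_rat_1)

lemma order_num_poly:
  fixes z :: "'a::field_char_0"
  assumes "\<not> l dvd r" "z \<noteq> 0"
  shows "order z (num_poly r l k) = card {j\<in>{..k}. (z ^ l) ^ j = z ^ r}"
proof -
  have ne: "r \<noteq> l * j" for j
    using assms(1) by auto
  have "order z (num_poly r l k) = (\<Sum>j\<le>k. order z (monom 1 r - monom 1 (l * j)))"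
    unfolding num_poly_def by (rule order_prod) (simp add: monom_1_eq_iff ne)
  also have "\<dots> = (\<Sum>j\<le>k. if (z ^ l) ^ j = z ^ r then 1 else 0)"
    by (intro sum.cong refl, subst order_monom_diff)
      (use assms(2) ne in \<open>auto simp: power_mult\<close>)
  also have "\<dots> = card {j\<in>{..k}. (z ^ l) ^ j = z ^ r}"
    by (simp add: sum.If_cases Int_def)
  finally show ?thesis .
qed

lemma order_den_poly:
  fixes z :: "'a::field_char_0"
  assumes "l > 0" "z \<noteq> 0" "z \<noteq> 1"
  shows "order z (den_poly r l k) = card {j\<in>{1..k}. (z ^ l) ^ j = 1}"
proof -
  let ?p = "\<Prod>j\<in>{1..k}. monom 1 0 - monom 1 (l * j) :: 'a poly"
  \<comment> \<open>The two outer factors can vanish only at 0 and 1, which are excluded.\<close>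
  have "order z (monom (1::'a) (r * Suc k)) = 0"
    using assms(2) by (intro order_0I) (simp add: poly_monom)
  moreover have "order z (monom (1::'a) 0 - monom 1 1) = 0"
    using assms(3) by (intro order_0I) (simp add: poly_monom)
  moreover have "den_poly r l k \<noteq> (0 :: 'a poly)"
    using assms(1) by (rule den_poly_nonzero)
  ultimately have "order z (den_poly r l k) = order z ?p"
    unfolding den_poly_def by (simp only: order_mult mult_eq_0_iff de_Morgan_disj simp_thms add_0_left
        add_0_right not_False_eq_True)
  also have "\<dots> = (\<Sum>j\<in>{1..k}. order z (monom 1 0 - monom 1 (l * j)))"
    by (rule order_prod) (use assms(1) in \<open>auto simp: monom_1_eq_iff\<close>)
  also have "\<dots> = (\<Sum>j\<in>{1..k}. if (z ^ l) ^ j = 1 then 1 else 0)"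
    by (intro sum.cong refl, subst order_monom_diff)
      (use assms in \<open>auto simp: power_mult\<close>)
  also have "\<dots> = card {j\<in>{1..k}. (z ^ l) ^ j = 1}"
    by (simp add: sum.If_cases Int_def)
  finally show ?thesis .
qed

lemma to_fract_monom: "to_fract (monom 1 n) = qvar ^ n"
  by (simp add: monom_altdef to_fract_power qvar_def)

lemma qvar_power_eq_1_iff: "qvar ^ n = 1 \<longleftrightarrow> n = 0"
proof -
  have "qvar ^ n = 1 \<longleftrightarrow> to_fract (monom (1::rat) n) = to_fract (monom 1 0)"
    by (simp only: to_fract_monom power_0)
  also have "\<dots> \<longleftrightarrow> n = 0"
    by (simp only: to_fract_eq_iff monom_1_eq_iff)
  finally show ?thesis .
qed

lemma to_fract_prod: "to_fract (prod f A) = (\<Prod>x\<in>A. to_fract (f x))"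
  by (induction A rule: infinite_finite_induct) simp_all

text \<open>Passes from the telescoped factors to polynomials whose roots can be counted; the power
  \<open>qvar ^ (r * Suc k)\<close> cancels.\<close>

lemma qpoch_quotient:
  "qpoch (qvar powi (- int r)) (qvar ^ l) (Suc k) / qpoch (qvar ^ l) (qvar ^ l) k / (1 - qvar)
    = to_fract (num_poly r l k) / to_fract (den_poly r l k)"
proof -
  have "to_fract (num_poly r l k) = (\<Prod>j\<le>k. qvar ^ r - qvar ^ (l * j))"
    by (simp add: num_poly_def to_fract_prod to_fract_monom)
  also have "\<dots> = (\<Prod>j\<le>k. qvar ^ r * (1 - qvar powi (- int r) * (qvar ^ l) ^ j))"
    using qvar_neq_0 by (simp add: right_diff_distrib power_int_minus flip: power_mult mult.assoc)
  also have "\<dots> = qvar ^ (r * Suc k) * qpoch (qvar powi (- int r)) (qvar ^ l) (Suc k)"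
    by (simp add: prod.distrib qpoch_def lessThan_Suc_atMost power_add flip: power_mult)
  finally have num: "to_fract (num_poly r l k) = \<dots>" .
  have "qpoch (qvar ^ l) (qvar ^ l) k = (\<Prod>j<k. 1 - qvar ^ (l * Suc j))"
    by (simp add: qpoch_def power_mult power_add)
  also have "\<dots> = (\<Prod>j\<in>{1..k}. 1 - qvar ^ (l * j))"
    by (rule prod.reindex_bij_witness [of _ "\<lambda>j. j - 1" Suc]) auto
  finally have "to_fract (den_poly r l k)
      = qvar ^ (r * Suc k) * qpoch (qvar ^ l) (qvar ^ l) k * (1 - qvar)"
    by (simp only: den_poly_def to_fract_prod to_fract_monom to_fract_mult to_fract_diff power_0
        power_one_right)
  thus ?thesis
    using qvar_neq_0 by (simp add: num)
qed

lemma qint_shift: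
  "qint (int l * int k - int r) = (1 - qvar powi (- int r) * (qvar ^ l) ^ k) / (1 - qvar)"
  using qvar_neq_0 by (simp add: qint_def power_int_diff power_int_minus field_simps
      flip: power_mult of_nat_mult)

subsection \<open>The modulus\<close>

text \<open>In \<open>1 - q ^ m = (1 - q) * [m]\<close> the left side has simple roots, and the
  factor \<open>1 - q\<close> accounts for the root 1.\<close>

lemma order_qint_poly:
  fixes z :: complex
  assumes "m > 0"
  shows "order z (map_poly of_rat (qint_poly m)) = (if z ^ m = 1 \<and> z \<noteq> 1 then 1 else 0)"
proof -
  let ?p = "map_poly of_rat (qint_poly m) :: complex poly"
  let ?c = "monom 1 0 - monom 1 1 :: complex poly"
  have "monom 1 0 - monom 1 m = (monom 1 0 - monom 1 1) * qint_poly m"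
    by (simp only: qint_poly_def monom_altdef smult_1_left power_0 power_one_right one_diff_power_eq)
  hence "map_poly of_rat (monom 1 0 - monom 1 m) = ?c * ?p"
    by (simp only: of_rat_poly_mult of_rat_monom_diff)
  hence eq: "monom 1 0 - monom 1 m = ?c * ?p"
    by (simp only: of_rat_monom_diff)
  have nz: "?c * ?p \<noteq> 0"
    unfolding eq [symmetric] using assms by (simp add: monom_1_eq_iff)
  have "order z ?c + order z ?p = order z (monom 1 0 - monom 1 m)"
    unfolding eq by (rule order_mult [OF nz, symmetric])
  moreover have "order z ?c = (if z = 1 then 1 else 0)" if "z \<noteq> 0"
    using order_monom_diff [of 0 1 z] that by auto
  moreover have "order z (monom 1 0 - monom 1 m) = (if z ^ m = 1 then 1 else 0)" if "z \<noteq> 0"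
    using order_monom_diff [of 0 m z] that assms by auto
  \<comment> \<open>The point 0 is outside the scope of \<open>order_monom_diff\<close>.\<close>
  moreover have "order 0 (monom 1 0 - monom 1 m :: complex poly) = 0"
    using assms by (intro order_0I) (simp add: poly_monom zero_power)
  ultimately show ?thesis
    using assms by (cases "z = 0") (auto simp: zero_power split: if_splits)
qed

lemma order_cyclotomic:
  assumes "m > 0"
  shows "order z (map_poly of_rat (cyclotomic m)) = (if z \<in> primitive_roots_unity m then 1 else 0)"
  using assms by (simp add: of_rat_cyclotomic order_prod_linear finite_primitive_roots_unity)

lemma modulus_nonzero:
  assumes "m > 0"
  shows "qint_poly m \<noteq> 0" "cyclotomic m \<noteq> 0"
proof -
  have "poly (qint_poly m) 1 \<noteq> 0"
    using assms by (simp add: qint_poly_def poly_sum)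
  thus "qint_poly m \<noteq> 0"
    by auto
  have "map_poly of_rat (cyclotomic m) \<noteq> (0 :: complex poly)"
    using finite_primitive_roots_unity [OF assms] by (simp add: of_rat_cyclotomic [OF assms])
  thus "cyclotomic m \<noteq> 0"
    by auto
qed

text \<open>A primitive root is a simple root of both \<open>[m]\<close> and the cyclotomic
  polynomial, which gives 1 + 3. For \<open>m > 1\<close> the point 1 is not primitive.\<close>

lemma order_modulus:
  fixes z :: complex
  assumes "m > 1"
  shows "order z (map_poly of_rat (qint_poly m * cyclotomic m ^ 3))
    = (if z ^ m = 1 \<and> z \<noteq> 1 then if z \<in> primitive_roots_unity m then 4 else 1 else 0)"
proof -
  have nz: "map_poly of_rat (qint_poly m) \<noteq> (0 :: complex poly)"
    "map_poly of_rat (cyclotomic m) \<noteq> (0 :: complex poly)"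
    using assms modulus_nonzero [of m] by (auto simp: of_rat_poly_eq_0_iff)
  have "z ^ m = 1 \<and> z \<noteq> 1" if "z \<in> primitive_roots_unity m"
    using that assms by (auto simp: primitive_roots_unity_def)
  thus ?thesis
    using assms nz
    by (auto simp: of_rat_poly_mult power3_eq_cube order_mult order_qint_poly order_cyclotomic)
qed

lemma primitive_root_power_eq_1:
  assumes "z \<in> primitive_roots_unity m" "m > 0" "z ^ k = 1"
  shows "m dvd k"
proof -
  have "z ^ m = 1"
    using assms by (simp add: primitive_roots_unity_def)
  then obtain d where d: "d > 0" "\<And>k. z ^ k = 1 \<longleftrightarrow> d dvd k"
    using root_of_unity_order assms(2) by blast
  have "d dvd m" "z ^ d = 1"
    using d \<open>z ^ m = 1\<close> by auto
  hence "d = m"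
    using assms(1,2) d(1) by (auto simp: primitive_roots_unity_def dest!: dvd_imp_le)
  thus ?thesis
    using d assms(3) by simp
qed

section \<open>Comparison of multiplicities for the collapsed sum\<close>

theorem theorem1p3:
  fixes r l m s :: nat
  assumes "r \<ge> 1" and "l \<ge> 2" and "m > 0"
    and "[int m = - int r] (mod int l)"
    and "gcd m l = 1"
    and "real m > (2 * real l * real s + real r) / (real l - 1)"
  shows "ratfun_cong_0
    (\<Sum>n = s..(m + r) div l + s.
       (qpoch (qvar powi (- int r)) (qvar ^ l) (n + s)
          * qpoch (qvar powi (- int r)) (qvar ^ l) (n - s)
          * (qpoch (qvar powi (- int r)) (qvar ^ l) n) ^ 2)
       / (qpoch (qvar ^ l) (qvar ^ l) (n + s)
          * qpoch (qvar ^ l) (qvar ^ l) (n - s)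
          * (qpoch (qvar ^ l) (qvar ^ l) n) ^ 2)
       * (qint (int l * (int n + int s) - int r)
            * qint (int l * (int n - int s) - int r)
            * (qint (int l * int n - int r)) ^ 2
          - qint (int l * (int n + int s))
            * qint (int l * (int n - int s))
            * (qint (int l * int n)) ^ 2))
    (qint_poly m * cyclotomic m ^ 3)"
proof -
  define N where "N = (m + r) div l"
  have "int l dvd int (m + r)"
    using assms(4) by (simp add: cong_iff_dvd_diff)
  hence "l dvd m + r"
    by (simp only: int_dvd_int_iff)
  hence N: "l * N = m + r"
    by (simp add: N_def)
  have "\<not> l dvd r"
  proof
    assume "l dvd r"
    hence "l dvd m"
      using \<open>l dvd m + r\<close> by (simp add: dvd_add_left_iff)
    hence "l dvd gcd m l"
      by simp
    thus False
      using assms(2,5) by simp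
  qed
  have "real (2 * l * s + r) < real (m * (l - 1))"
    using assms(2,6) by (simp add: of_nat_diff divide_less_eq algebra_simps)
  hence "2 * l * s + r < m * (l - 1)"
    by (simp only: of_nat_less_iff)
  \<comment> \<open>The left side is \<open>m + r + 2 * l * s\<close>, and
    \<open>m + m * (l - 1) = l * m\<close>.\<close>
  hence "l * (N + 2 * s) < l * m"
    using N assms(2) by (cases l) (auto simp: algebra_simps)
  hence small: "N + 2 * s < m"
    by simp
  have "N > 0"
    using N assms(3) by (auto intro: Nat.gr0I)
  hence "m > 1"
    using small by simp

  let ?X = "num_poly r l (N + 2 * s) * num_poly r l N * num_poly r l (N + s) ^ 2 :: rat poly"
  let ?Y = "den_poly r l (N + 2 * s) * den_poly r l N * den_poly r l (N + s) ^ 2 :: rat poly"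
  let ?P = "qint_poly m * cyclotomic m ^ 3"
  let ?h = "map_poly of_rat :: rat poly \<Rightarrow> complex poly"
  have nz: "?X \<noteq> 0" "?Y \<noteq> 0" "?P \<noteq> 0"
    using \<open>\<not> l dvd r\<close> assms(2,3) modulus_nonzero [OF assms(3)]
    by (simp_all add: num_poly_nonzero den_poly_nonzero)
  have ord: "order z (?h ?P) + order z (?h ?Y) \<le> order z (?h ?X)"
    if "poly (?h ?P) z = 0" for z
  proof -
    have "?h ?P \<noteq> 0"
      by (subst of_rat_poly_eq_0_iff) (rule nz(3))
    hence "order z (?h ?P) \<noteq> 0"
      using that by (simp only: order_root simp_thms)
    hence z: "z ^ m = 1" "z \<noteq> 1"
      by (auto simp: order_modulus [OF \<open>m > 1\<close>] split: if_splits)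
    have "z \<noteq> 0"
      using z assms(3) by (auto simp: zero_power)
    define w where "w = z ^ l"
    have "w ^ m = 1"
      using z(1) unfolding w_def by (metis power_mult mult.commute power_one)
    \<comment> \<open>Since \<open>l * N = m + r\<close> and \<open>z ^ m = 1\<close>, the condition
      \<open>w ^ j = z ^ r\<close> for a vanishing numerator factor takes the form counted in
      \<open>card_powers_eq_1_le\<close>.\<close>
    have "w ^ N = z ^ r"
      using z by (simp add: w_def N power_add flip: power_mult)
    define a where "a k = card {j\<in>{..k}. w ^ j = w ^ N}" for k
    define c where "c k = card {j\<in>{1..k}. w ^ j = 1}" for k
    have le: "c k \<le> a k" "c N < a N" for k
      using card_powers_eq_1_le [OF \<open>w ^ m = 1\<close> assms(3)] by (auto simp: a_def c_def)
    have "order z (num_poly r l k) = a k" for k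
      using \<open>\<not> l dvd r\<close> \<open>z \<noteq> 0\<close> by (simp add: order_num_poly a_def \<open>w ^ N = z ^ r\<close> w_def [symmetric])
    hence X: "order z (?h ?X) = a (N + 2 * s) + a N + 2 * a (N + s)"
      using \<open>\<not> l dvd r\<close>
      by (simp add: of_rat_poly_mult of_rat_num_poly power2_eq_square order_mult num_poly_nonzero)
    have "order z (den_poly r l k) = c k" for k
      using assms(2) \<open>z \<noteq> 0\<close> z(2) by (simp add: order_den_poly c_def w_def [symmetric])
    hence Y: "order z (?h ?Y) = c (N + 2 * s) + c N + 2 * c (N + s)"
      using assms(2)
      by (simp add: of_rat_poly_mult of_rat_den_poly power2_eq_square order_mult den_poly_nonzero)
    \<comment> \<open>As \<open>m\<close> is coprime to \<open>l\<close>, \<open>w ^ j = 1\<close>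
      would force \<open>m\<close> to divide \<open>j\<close>, impossible for
      \<open>0 < j < m\<close>. The numerator still vanishes through \<open>j = N\<close>.\<close>
    have prim: "c k < a k" if "z \<in> primitive_roots_unity m" "N \<le> k" "k \<le> N + 2 * s" for k
    proof -
      have "w ^ j \<noteq> 1" if "j \<in> {1..k}" for j
      proof
        assume "w ^ j = 1"
        hence "m dvd l * j"
          using primitive_root_power_eq_1 [OF \<open>z \<in> primitive_roots_unity m\<close> assms(3)]
          by (simp add: w_def power_mult)
        hence "m dvd j"
          using assms(5) by (simp add: coprime_iff_gcd_eq_1 coprime_dvd_mult_right_iff)
        thus False
          using that \<open>k \<le> N + 2 * s\<close> small by (auto dest!: dvd_imp_le)
      qed
      hence "c k = 0"
        by (auto simp: c_def)
      moreover have "a k > 0"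
        using \<open>N \<le> k\<close> by (auto simp: a_def card_gt_0_iff)
      ultimately show ?thesis
        by simp
    qed
    show ?thesis
    proof (cases "z \<in> primitive_roots_unity m")
      case True
      \<comment> \<open>Each of the four factors contributes an excess of at least 1; the one at
        \<open>N + s\<close> occurs squared.\<close>
      hence "order z (?h ?P) = 4"
        using z by (simp add: order_modulus [OF \<open>m > 1\<close>])
      thus ?thesis
        unfolding X Y using prim [OF True, of N] prim [OF True, of "N + s"]
          prim [OF True, of "N + 2 * s"] by simp
    next
      case False
      \<comment> \<open>Here the strict inequality at \<open>N\<close> alone supplies the required
        excess.\<close>
      hence "order z (?h ?P) = 1"
        using z by (simp add: order_modulus [OF \<open>m > 1\<close>])
      thus ?thesis
        unfolding X Y using le(1) [of "N + s"] le(1) [of "N + 2 * s"] le(2) by simp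
    qed
  qed

  \<comment> \<open>The exponents are natural because \<open>s \<le> n\<close>;
    \<open>qint_shift\<close> with \<open>r = 0\<close> covers the q-integers without shift.\<close>
  have int: "qint (int l * (int n + int s) - int r)
        = (1 - qvar powi (- int r) * (qvar ^ l) ^ (n + s)) / (1 - qvar)"
      "qint (int l * (int n - int s) - int r)
        = (1 - qvar powi (- int r) * (qvar ^ l) ^ (n - s)) / (1 - qvar)"
      "qint (int l * (int n + int s)) = (1 - (qvar ^ l) ^ (n + s)) / (1 - qvar)"
      "qint (int l * (int n - int s)) = (1 - (qvar ^ l) ^ (n - s)) / (1 - qvar)"
      "qint (int l * int n) = (1 - (qvar ^ l) ^ n) / (1 - qvar)"
    if "n \<in> {s..N + s}" for n
    using qint_shift [of l "n + s" r] qint_shift [of l "n - s" r] qint_shift [of l "n + s" 0]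
      qint_shift [of l "n - s" 0] qint_shift [of l n 0] that
    by (simp_all add: of_nat_diff)
  have x: "\<forall>k>0. (qvar ^ l) ^ k \<noteq> 1"
    using assms(2) by (simp add: qvar_power_eq_1_iff flip: power_mult)
  have "to_fract ?X / to_fract ?Y
      = to_fract (num_poly r l (N + 2 * s)) / to_fract (den_poly r l (N + 2 * s))
        * (to_fract (num_poly r l N) / to_fract (den_poly r l N))
        * (to_fract (num_poly r l (N + s)) / to_fract (den_poly r l (N + s))) ^ 2"
    by (simp only: to_fract_mult to_fract_power power_divide times_divide_times_eq)
  also have "\<dots> = (\<Sum>n = s..N + s.
       (qpoch (qvar powi (- int r)) (qvar ^ l) (n + s)
          * qpoch (qvar powi (- int r)) (qvar ^ l) (n - s)
          * (qpoch (qvar powi (- int r)) (qvar ^ l) n) ^ 2)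
       / (qpoch (qvar ^ l) (qvar ^ l) (n + s)
          * qpoch (qvar ^ l) (qvar ^ l) (n - s)
          * (qpoch (qvar ^ l) (qvar ^ l) n) ^ 2)
       * (qint (int l * (int n + int s) - int r)
            * qint (int l * (int n - int s) - int r)
            * (qint (int l * int n - int r)) ^ 2
          - qint (int l * (int n + int s))
            * qint (int l * (int n - int s))
            * (qint (int l * int n)) ^ 2))"
    unfolding qpoch_quotient [symmetric] telescoping_sum [OF x, symmetric]
    by (intro sum.cong refl) (simp only: int qint_shift)
  finally show ?thesis
    unfolding N_def [symmetric] using ratfun_cong_0_orderI [OF nz ord] by (simp only:)
qed

end
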